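(* Let $n\ge1$. With commuting indeterminates $y_1,\dots,y_n,s,t$, $$\sum_{\sigma\in B_n}(-1)^{\mathrm{cyc}(\sigma)}s^{\mathrm{neg}(\sigma)}t^{\mathrm{nsum}(\sigma)}\prod_{j\in\mathrm{RLM_B}(\sigma)}y_j=(-1)^n\prod_{\substack{i\in[n]\\ i\text{ even}}}(y_i-1)\prod_{\substack{i\in[n]\\ i\text{ odd}}}(y_i+st^i).$$
   Context: $B_n$ is the set of permutations $\sigma$ of $\{\pm1,\dots,\pm n\}$ with $\sigma(-i)=-\sigma(i)$ for all $i\in[n]$, identified with the word $\sigma(1)\cdots\sigma(n)$; $|\sigma|$ denotes the permutation $i\mapsto|\sigma(i)|$ of $[n]$, and $\mathrm{cyc}(\sigma)$ is the number of cycles of $|\sigma|$. $\mathrm{Neg}(\sigma)=\{i\in[n]:\sigma(i)<0\}$, $\mathrm{neg}(\sigma)=\#\mathrm{Neg}(\sigma)$, $\mathrm{nsum}(\sigma)=\sum_{i\in\mathrm{Neg}(\sigma)}|\sigma(i)|$. The set of right-to-left minimum values is $\mathrm{RLM_B}(\sigma)=\{\sigma(i):i\in[n],\ 0<\sigma(i)<|\sigma(j)|\text{ for all }j>i\}$. *)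

theory Defs
  imports "HOL-Combinatorics.Orbits" "HOL-Library.Poly_Mapping"
begin

text \<open>As usual for \<^const>\<open>permutes\<close>, a signed permutation is a function on all integers that is
  the identity outside of the set $\{\pm 1, \dots, \pm n\}$.\<close>

definition signed_perms :: "nat \<Rightarrow> (int \<Rightarrow> int) set" where
  "signed_perms n =
     {\<sigma>. \<sigma> permutes {- int n..int n} - {0} \<and> (\<forall>i\<in>{1..int n}. \<sigma> (- i) = - \<sigma> i)}"

definition abs_perm :: "(int \<Rightarrow> int) \<Rightarrow> nat \<Rightarrow> nat" where
  "abs_perm \<sigma> i = nat \<bar>\<sigma> (int i)\<bar>"

lemma abs_perm_permutes:
  assumes "\<sigma> \<in> signed_perms n"
  shows "abs_perm \<sigma> permutes {1..n}"
proof (rule bij_imp_permutes)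
  have p: "\<sigma> permutes {- int n..int n} - {0}"
    and odd: "\<And>i. i \<in> {1..int n} \<Longrightarrow> \<sigma> (- i) = - \<sigma> i"
    using assms by (auto simp: signed_perms_def)
  have im: "\<sigma> (int i) \<in> {- int n..int n} - {0}" if "i \<in> {1..n}" for i
    using permutes_in_image[OF p, of "int i"] that by auto
  have "inj_on (abs_perm \<sigma>) {1..n}"
  proof (rule inj_onI)
    fix i j assume i: "i \<in> {1..n}" and j: "j \<in> {1..n}" and eq: "abs_perm \<sigma> i = abs_perm \<sigma> j"
    have "\<sigma> (int i) = \<sigma> (int j) \<or> \<sigma> (int i) = \<sigma> (- int j)"
      using eq odd[of "int j"] j by (auto simp: abs_perm_def abs_if split: if_splits)
    then have "int i = int j \<or> int i = - int j"
      using permutes_inj[OF p] by (metis injD)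
    then show "i = j"
      using i j by auto
  qed
  moreover have "abs_perm \<sigma> ` {1..n} \<subseteq> {1..n}"
  proof (rule image_subsetI)
    fix i assume "i \<in> {1..n}"
    from im[OF this] show "abs_perm \<sigma> i \<in> {1..n}"
      by (auto simp: abs_perm_def)
  qed
  ultimately show "bij_betw (abs_perm \<sigma>) {1..n} {1..n}"
    by (simp add: bij_betw_def endo_inj_surj)
next
  fix i assume "i \<notin> {1..n}"
  then have "int i \<notin> {- int n..int n} - {0}"
    by auto
  then show "abs_perm \<sigma> i = i"
    using assms by (auto simp: signed_perms_def abs_perm_def permutes_not_in)
qed

text \<open>Cycles are counted through their underlying sets, the orbits on $[n]$; fixed points count
  as cycles.\<close>

definition cyc :: "nat \<Rightarrow> (int \<Rightarrow> int) \<Rightarrow> nat" where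
  "cyc n \<sigma> = card (orbit (abs_perm \<sigma>) ` {1..n})"

definition Neg :: "nat \<Rightarrow> (int \<Rightarrow> int) \<Rightarrow> int set" where
  "Neg n \<sigma> = {i \<in> {1..int n}. \<sigma> i < 0}"

definition neg :: "nat \<Rightarrow> (int \<Rightarrow> int) \<Rightarrow> nat" where
  "neg n \<sigma> = card (Neg n \<sigma>)"

definition nsum :: "nat \<Rightarrow> (int \<Rightarrow> int) \<Rightarrow> nat" where
  "nsum n \<sigma> = (\<Sum>i\<in>Neg n \<sigma>. nat \<bar>\<sigma> i\<bar>)"

definition RLM_B :: "nat \<Rightarrow> (int \<Rightarrow> int) \<Rightarrow> int set" where
  "RLM_B n \<sigma> = {\<sigma> i |i. i \<in> {1..int n} \<and> 0 < \<sigma> i \<and> (\<forall>j\<in>{i<..int n}. \<sigma> i < \<bar>\<sigma> j\<bar>)}"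

text \<open>Multivariate polynomials over the integers: a monomial is a finitely supported map from
  indeterminates to exponents, and a polynomial is a finitely supported map from monomials to
  coefficients; \<^const>\<open>times\<close> on these is the convolution product. The ring has an indeterminate
  $y_j$ for every natural number $j$, so that it does not depend on $n$.\<close>

datatype indet = Y nat | S | T

type_synonym polynomial = "(indet \<Rightarrow>\<^sub>0 nat) \<Rightarrow>\<^sub>0 int"

definition var :: "indet \<Rightarrow> polynomial" where
  "var v = Poly_Mapping.single (Poly_Mapping.single v 1) 1"

abbreviation y :: "nat \<Rightarrow> polynomial" where "y j \<equiv> var (Y j)"
abbreviation s :: polynomial where "s \<equiv> var S"
abbreviation t :: polynomial where "t \<equiv> var T"

end

theory Submission
  imports Defs
begin

text \<open>
  A signed permutation amounts to a permutation $\pi$ of $[n]$ together with the set of absolute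
  values that carry a minus sign. For fixed $\pi$ the signs are chosen independently, so the sum
  over them factors: $j$ contributes $a_j = y_j + s t^j$ if it is a right-to-left minimum of $\pi$
  and $b_j = 1 + s t^j$ otherwise. As $(-1)^{\mathrm{cyc}(\pi)} = (-1)^n \mathrm{sgn}(\pi)$, what
  remains is a signed sum over $S_n$. Removing the largest value $n$, which is a right-to-left
  minimum only in last position, multiplies the sum by
  $a_n + b_n \sum_{r=1}^{n-1} (-1)^r$, because moving $n$ by one position flips the sign and leaves
  the weight of the smaller values alone. The factor is $a_n$ for odd $n$ and $a_n - b_n$ for
  even $n$.
\<close>

section \<open>Parity of the number of cycles\<close>

text \<open>Induction on \<open>A\<close>: composing \<open>p\<close> with the transposition of
  \<open>a\<close> and \<open>p a\<close> cuts \<open>a\<close> out of its cycle. If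
  \<open>a\<close> is fixed, one orbit disappears and the sign stays; otherwise the number of orbits
  stays and the sign flips. Both agree with the extra factor -1 from \<open>card A\<close>.\<close>

lemma minus_one_power_card_orbits:
  assumes "finite A" and "p permutes A"
  shows "(- 1) ^ card (orbit p ` A) = (- 1) ^ card A * sign p"
  using assms
proof (induction A arbitrary: p rule: finite_induct)
  case empty
  then show ?case by simp
next
  case (insert a A)
  define b where "b = p a"
  define q where "q = transpose a b \<circ> p"
  have q: "q permutes A"
    unfolding q_def b_def using insert.prems by (rule permutes_insert_lemma)
  have p_eq: "p = transpose a b \<circ> q"
    by (simp add: q_def fun_eq_iff)
  have perm_p: "permutation p"
    using insert.prems insert.hyps by (metis finite_insert permutation_permutes)
  have perm_q: "permutation q"
    using q insert.hyps by (metis permutation_permutes)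
  have sign_p: "sign p = (if a = b then sign q else - sign q)"
    unfolding p_eq using perm_q by (simp add: sign_compose permutation_swap_id sign_swap_id)
  show ?case
  proof (cases "a = b")
    case True
    then have "p = q" by (simp add: p_eq)
    have "orbit p a = {a}"
      using True by (simp add: b_def orbit_eq_singleton_iff)
    moreover have "{a} \<notin> orbit p ` A"
      using permutes_orbit_subset[OF q] \<open>a \<notin> A\<close> \<open>p = q\<close> by fastforce
    ultimately show ?thesis
      using insert.IH[OF q] insert.hyps \<open>p = q\<close> by simp
  next
    case False
    have "b \<in> A"
      using permutes_in_image[OF insert.prems, of a] False by (simp add: b_def)
    \<comment> \<open>\<open>q\<close> is the first-return map of \<open>p\<close> to \<open>A\<close>\<close>
    have q_eq: "q z = (if p z = a then b else p z)" if "z \<noteq> a" for z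
      using that injD[OF permutes_inj[OF insert.prems], of z a]
      by (auto simp: q_def b_def transpose_def)
    have orbit_q: "orbit p x \<inter> A = orbit q x" if "x \<in> A" for x
    proof
      \<comment> \<open>The plain inclusion is not inductive, since the orbit of \<open>p\<close>
        may pass through \<open>a\<close>, which \<open>q\<close> skips. At \<open>a\<close> the
        claim therefore concerns \<open>b\<close>, the next point of \<open>p\<close>.\<close>
      have "(if z = a then b \<in> orbit q x else z \<in> orbit q x)" if "z \<in> orbit p x" for z
        using that
      proof induction
        case base
        have "x \<noteq> a" using \<open>x \<in> A\<close> \<open>a \<notin> A\<close> by auto
        then show ?case
          using q_eq[of x] orbit.base[of q x] by (auto split: if_splits)
      next
        case (step z)
        then show ?case
          using q_eq[of z] orbit.step[of z q x] False
          by (cases "z = a") (auto simp flip: b_def split: if_splits)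
      qed
      then show "orbit p x \<inter> A \<subseteq> orbit q x"
        using \<open>a \<notin> A\<close> by (metis IntE subsetI)
    next
      \<comment> \<open>A step of \<open>q\<close> is one step of \<open>p\<close>, or two with
        \<open>a\<close> in between.\<close>
      have "z \<in> orbit p x" if "z \<in> orbit q x" for z
        using that
      proof induction
        case base
        have "x \<noteq> a" using \<open>x \<in> A\<close> \<open>a \<notin> A\<close> by auto
        then show ?case
          using q_eq[of x] orbit.base[of p x] orbit.step[of a p x] by (auto simp: b_def)
      next
        case (step z)
        have "z \<noteq> a"
          using step.hyps permutes_orbit_subset[OF q \<open>x \<in> A\<close>] \<open>a \<notin> A\<close> by auto
        then show ?case
          using q_eq[of z] orbit.step[OF step.IH] orbit.step[of a p x] by (auto simp: b_def)
      qed
      then show "orbit q x \<subseteq> orbit p x \<inter> A"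
        using permutes_orbit_subset[OF q \<open>x \<in> A\<close>] by auto
    qed
    \<comment> \<open>The cycle of \<open>a\<close> is also represented by \<open>b\<close> in
      \<open>A\<close>, so dropping \<open>a\<close> loses no orbit.\<close>
    have "orbit p a = orbit p b"
      using permutation_orbit_step[OF perm_p] by (simp add: b_def)
    then have "orbit p ` insert a A = orbit p ` A"
      using \<open>b \<in> A\<close> by auto
    \<comment> \<open>Each of these orbits contains its representative from \<open>A\<close>, so
      orbits with equal traces on \<open>A\<close> share a point and coincide.\<close>
    moreover have "inj_on (\<lambda>X. X \<inter> A) (orbit p ` A)"
    proof (rule inj_onI, clarify)
      fix x x' assume "x \<in> A" "x' \<in> A" "orbit p x \<inter> A = orbit p x' \<inter> A"
      then have "x \<in> orbit p x'"
        using permutation_self_in_orbit[OF perm_p, of x] by auto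
      then show "orbit p x = orbit p x'"
        using cyclic_on_orbit'[OF perm_p] orbit_cyclic_eq3 by metis
    qed
    then have "card ((\<lambda>X. X \<inter> A) ` orbit p ` A) = card (orbit p ` A)"
      by (rule card_image)
    moreover have "(\<lambda>X. X \<inter> A) ` orbit p ` A = orbit q ` A"
      unfolding image_image using orbit_q by (rule image_cong[OF refl])
    ultimately show ?thesis
      using insert.IH[OF q] insert.hyps False sign_p by simp
  qed
qed

section \<open>Signed sums over permutations weighted by records\<close>

text \<open>A value $j$ is a right-to-left minimum of a permutation if and only if the inverse permutation
  has a record, i.e. a left-to-right maximum, at position $j$.\<close>

definition record_at :: "(nat \<Rightarrow> nat) \<Rightarrow> nat \<Rightarrow> bool" where
  "record_at p j \<longleftrightarrow> (\<forall>i\<in>{1..<j}. p i < p j)"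

definition record_weight :: "(nat \<Rightarrow> 'a::comm_monoid_mult) \<Rightarrow> (nat \<Rightarrow> 'a) \<Rightarrow> nat \<Rightarrow> (nat \<Rightarrow> nat) \<Rightarrow> 'a"
  where "record_weight a b n p = (\<Prod>j\<in>{1..n}. if record_at p j then a j else b j)"

text \<open>Exchanging the adjacent values \<open>k\<close> and \<open>Suc k\<close> only affects
  the comparison of the two positions that hold them. One of these is position \<open>Suc n\<close>,
  which the weight over positions up to \<open>n\<close> never inspects.\<close>

lemma record_weight_transpose:
  assumes p: "p permutes {1..Suc n}" and last: "p (Suc n) = k \<or> p (Suc n) = Suc k"
  shows "record_weight a b n (transpose k (Suc k) \<circ> p) = record_weight a b n p"
proof -
  have "(transpose k (Suc k) (p i) < transpose k (Suc k) (p j)) \<longleftrightarrow> p i < p j"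
    if "i < j" "j \<le> n" for i j
  proof -
    have "p i \<noteq> p (Suc n)" "p j \<noteq> p (Suc n)" "p i \<noteq> p j"
      using that injD[OF permutes_inj[OF p]] by (metis less_irrefl less_Suc_eq_le less_trans)+
    then show ?thesis
      using last by (auto simp: transpose_def)
  qed
  then show ?thesis
    unfolding record_weight_def record_at_def by (intro prod.cong refl if_cong) auto
qed

text \<open>Permutations are grouped by their last value. As \<open>p\<close> stands for an inverse,
  this value is the position of the largest entry, and passing from one position to the next flips
  the sign of the group.\<close>

lemma sum_sign_record_weight_Suc:
  fixes a b :: "nat \<Rightarrow> 'a::comm_ring_1"
  defines "F \<equiv> \<lambda>n. \<Sum>p | p permutes {1..n}. of_int (sign p) * record_weight a b n p"
  shows "F (Suc n) = F n * (a (Suc n) - (if even (Suc n) then b (Suc n) else 0))"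
proof -
  define P where "P = {p. p permutes {1..Suc n}}"
  \<comment> \<open>Only positions up to \<open>n\<close> are weighted here: the factor of position
    \<open>Suc n\<close> depends on \<open>k\<close> alone and is multiplied in afterwards.\<close>
  define G where "G k = (\<Sum>p | p \<in> P \<and> p (Suc n) = k. of_int (sign p) * record_weight a b n p)"
    for k
  have fin: "finite P"
    by (simp add: P_def finite_permutations)
  have last_in: "p (Suc n) \<in> {1..Suc n}" if "p \<in> P" for p
    using that permutes_in_image[of p "{1..Suc n}" "Suc n"] by (simp add: P_def)
  have record_last: "record_at p (Suc n) \<longleftrightarrow> p (Suc n) = Suc n" if "p \<in> P" for p
  proof
    assume rec: "record_at p (Suc n)"
    have p: "p permutes {1..Suc n}" using that by (simp add: P_def)
    have "Suc n \<in> p ` {1..Suc n}"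
      unfolding permutes_image[OF p] by simp
    then obtain i where i: "p i = Suc n" "i \<in> {1..Suc n}"
      by (elim imageE) (simp only:)
    with rec last_in[OF that] show "p (Suc n) = Suc n"
      by (cases "i = Suc n") (auto simp: record_at_def dest!: bspec[of _ _ i])
  next
    assume eq: "p (Suc n) = Suc n"
    have p: "p permutes {1..Suc n}" using that by (simp add: P_def)
    show "record_at p (Suc n)"
      unfolding record_at_def
    proof
      fix i assume i: "i \<in> {1..<Suc n}"
      then have "p i \<in> {1..Suc n}"
        using permutes_in_image[OF p, of i] by simp
      moreover have "p i \<noteq> p (Suc n)"
        using i injD[OF permutes_inj[OF p], of i "Suc n"] by auto
      ultimately show "p i < p (Suc n)" using eq by auto
    qed
  qed
  have G_top: "G (Suc n) = F n"
  proof -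
    have "p permutes {1..n} \<longleftrightarrow> p \<in> P \<and> p (Suc n) = Suc n" for p
    proof
      assume p: "p permutes {1..n}"
      have "p permutes {1..Suc n}"
        using p by (rule permutes_subset) simp
      moreover have "p (Suc n) = Suc n"
        using permutes_not_in[OF p, of "Suc n"] by simp
      ultimately show "p \<in> P \<and> p (Suc n) = Suc n"
        by (simp add: P_def)
    next
      assume p: "p \<in> P \<and> p (Suc n) = Suc n"
      then have "p permutes {1..Suc n}" by (simp add: P_def)
      then show "p permutes {1..n}"
      proof (rule permutes_superset)
        fix x assume "x \<in> {1..Suc n} - {1..n}"
        then have "x = Suc n" by auto
        with p show "p x = x" by simp
      qed
    qed
    then show ?thesis by (simp add: G_def F_def)
  qed
  \<comment> \<open>Composition with the transposition of \<open>k\<close> and \<open>Suc k\<close>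
    matches the two groups, keeps the weight and flips the sign.\<close>
  have G_step: "G k = - G (Suc k)" if "k \<in> {1..n}" for k
  proof -
    let ?\<tau> = "transpose k (Suc k)"
    have comp: "?\<tau> \<circ> p \<in> P" if "p \<in> P" for p
      using that \<open>k \<in> {1..n}\<close> by (auto simp: P_def intro!: permutes_compose permutes_swap_id)
    have "G k = (\<Sum>p | p \<in> P \<and> p (Suc n) = Suc k. - (of_int (sign p) * record_weight a b n p))"
      unfolding G_def
    proof (rule sum.reindex_bij_witness[where i = "\<lambda>p. ?\<tau> \<circ> p" and j = "\<lambda>p. ?\<tau> \<circ> p"];
           clarsimp simp: comp)
      fix p assume p: "p \<in> P" "k = p (Suc n)"
      have "permutation p"
        using p by (auto simp: P_def permutation_permutes)
      then have "sign (?\<tau> \<circ> p) = - sign p"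
        by (simp add: sign_compose permutation_swap_id sign_swap_id)
      moreover have "record_weight a b n (?\<tau> \<circ> p) = record_weight a b n p"
        using p by (intro record_weight_transpose) (auto simp: P_def)
      ultimately show "- (of_int (sign (transpose (p (Suc n)) (Suc (p (Suc n))) \<circ> p)) *
          record_weight a b n (transpose (p (Suc n)) (Suc (p (Suc n))) \<circ> p))
        = of_int (sign p) * record_weight a b n p"
        using p by simp
    qed (auto simp: fun_eq_iff)
    then show ?thesis by (simp add: sum_negf G_def)
  qed
  \<comment> \<open>The index runs downwards from \<open>Suc n\<close>, the only group known
    directly.\<close>
  have G_eq: "G (Suc n - r) = (- 1) ^ r * F n" if "r \<le> n" for r
    using that
  proof (induction r)
    case (Suc r)
    then have "G (Suc n - Suc r) = - G (Suc n - r)"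
      using G_step[of "Suc n - Suc r"] by (simp add: Suc_diff_le)
    with Suc show ?case by simp
  qed (simp add: G_top)
  \<comment> \<open>With \<open>m = n\<close> the sum is -1 exactly when \<open>Suc n\<close> is
    even, which is where \<open>b (Suc n)\<close> survives.\<close>
  have alt: "(\<Sum>r\<in>{1..m}. (- 1) ^ r) = (if even m then 0 else (- 1 :: 'a))" for m
    by (induction m) auto
  have "F (Suc n) = (\<Sum>p\<in>P. of_int (sign p) * record_weight a b n p *
                        (if p (Suc n) = Suc n then a (Suc n) else b (Suc n)))"
    unfolding F_def P_def[symmetric]
    by (intro sum.cong refl) (simp add: record_weight_def record_last)
  also have "\<dots> = (\<Sum>k\<in>{1..Suc n}. G k * (if k = Suc n then a (Suc n) else b (Suc n)))"
    unfolding G_def sum_distrib_right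
    by (subst sum.group[OF fin, of "{1..Suc n}" "\<lambda>p. p (Suc n)", symmetric])
       (use last_in in \<open>auto intro!: sum.cong\<close>)
  also have "\<dots> = (\<Sum>k\<in>{1..n}. G k) * b (Suc n) + F n * a (Suc n)"
    by (simp add: G_top sum_distrib_right)
  also have "(\<Sum>k\<in>{1..n}. G k) = (\<Sum>r\<in>{1..n}. G (Suc n - r))"
    by (rule sum.reindex_bij_witness[where i = "\<lambda>r. Suc n - r" and j = "\<lambda>k. Suc n - k"]) auto
  also have "\<dots> = (\<Sum>r\<in>{1..n}. (- 1) ^ r) * F n"
    unfolding sum_distrib_right by (intro sum.cong refl G_eq) simp
  finally show ?thesis
    unfolding alt by (simp add: algebra_simps)
qed

lemma sum_sign_record_weight:
  fixes a b :: "nat \<Rightarrow> 'a::comm_ring_1"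
  shows "(\<Sum>p | p permutes {1..n}. of_int (sign p) * record_weight a b n p)
       = (\<Prod>i\<in>{1..n}. a i - (if even i then b i else 0))"
proof (induction n)
  case 0
  have "{p. p permutes {1..0::nat}} = {id}" by auto
  then show ?case by (simp add: record_weight_def)
next
  case (Suc n)
  then show ?case unfolding sum_sign_record_weight_Suc by simp
qed

section \<open>Signed permutations as pairs of a permutation and a set of negated values\<close>

text \<open>\<open>N\<close> is the set of absolute values, not of positions, that carry a minus sign.\<close>

definition signed_perm :: "(nat \<Rightarrow> nat) \<Rightarrow> nat set \<Rightarrow> int \<Rightarrow> int" where
  "signed_perm p N i = sgn i * (if p (nat \<bar>i\<bar>) \<in> N then - 1 else 1) * int (p (nat \<bar>i\<bar>))"

text \<open>Recovers \<open>N\<close> from a signed permutation. Only images of positive positions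
  count, because over all positions every nonzero value in range is attained with both
  signs.\<close>

definition neg_values :: "nat \<Rightarrow> (int \<Rightarrow> int) \<Rightarrow> nat set" where
  "neg_values n \<sigma> = {j \<in> {1..n}. - int j \<in> \<sigma> ` {1..int n}}"

text \<open>The definition demands oddness on positive positions only. Negative ones follow by
  negating the argument; elsewhere \<open>\<sigma>\<close> is the identity.\<close>

lemma signed_perms_minus:
  assumes "\<sigma> \<in> signed_perms n"
  shows "\<sigma> (- i) = - \<sigma> i"
proof -
  have p: "\<sigma> permutes {- int n..int n} - {0}"
    and odd: "\<And>i. i \<in> {1..int n} \<Longrightarrow> \<sigma> (- i) = - \<sigma> i"
    using assms by (auto simp: signed_perms_def)
  consider "i \<in> {1..int n}" | "- i \<in> {1..int n}" | "i \<notin> {- int n..int n} - {0}"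
    by fastforce
  then show ?thesis
  proof cases
    case 3
    then have "- i \<notin> {- int n..int n} - {0}" by auto
    with 3 show ?thesis using permutes_not_in[OF p] by metis
  qed (use odd[of i] odd[of "- i"] in auto)
qed

context
  fixes p :: "nat \<Rightarrow> nat" and N :: "nat set" and n :: nat
  assumes p: "p permutes {1..n}"
begin

text \<open>Ensures that the sign attached by \<open>signed_perm\<close> is visible: a negated value
  is never zero at a nonzero argument.\<close>

lemma permutes_eq_0_iff: "p m = 0 \<longleftrightarrow> m = 0"
  using permutes_not_in[OF p, of 0] injD[OF permutes_inj[OF p], of m 0] by auto

lemma abs_signed_perm: "\<bar>signed_perm p N i\<bar> = int (p (nat \<bar>i\<bar>))"
  using permutes_eq_0_iff[of 0] by (auto simp: signed_perm_def abs_mult sgn_if)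

lemma abs_perm_signed_perm: "abs_perm (signed_perm p N) = p"
  by (simp add: abs_perm_def abs_signed_perm fun_eq_iff)

lemma signed_perm_neg_iff:
  assumes "0 < i"
  shows "signed_perm p N i < 0 \<longleftrightarrow> p (nat i) \<in> N"
  using assms permutes_eq_0_iff[of "nat i"] by (auto simp: signed_perm_def)

lemma Neg_signed_perm: "Neg n (signed_perm p N) = int ` {m \<in> {1..n}. p m \<in> N}"
proof (rule set_eqI)
  fix i
  show "i \<in> Neg n (signed_perm p N) \<longleftrightarrow> i \<in> int ` {m \<in> {1..n}. p m \<in> N}"
  proof
    assume "i \<in> Neg n (signed_perm p N)"
    then have "i = int (nat i)" "nat i \<in> {m \<in> {1..n}. p m \<in> N}"
      by (auto simp: Neg_def signed_perm_neg_iff)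
    then show "i \<in> int ` {m \<in> {1..n}. p m \<in> N}" by blast
  qed (auto simp: Neg_def signed_perm_neg_iff)
qed

text \<open>Inversion exchanges positions and values: all later entries are larger than
  \<open>p m\<close> iff all smaller values sit at earlier positions, that is, iff
  \<open>inv p\<close> has a record at \<open>p m\<close>.\<close>

lemma RLM_B_signed_perm:
  "RLM_B n (signed_perm p N) = int ` {j \<in> {1..n} - N. record_at (inv p) j}"
proof -
  have rec: "record_at (inv p) (p m) \<longleftrightarrow> (\<forall>k\<in>{m<..n}. p m < p k)" if "m \<in> {1..n}" for m
  proof
    assume r: "record_at (inv p) (p m)"
    show "\<forall>k\<in>{m<..n}. p m < p k"
    proof (rule ballI, rule ccontr)
      fix k assume k: "k \<in> {m<..n}" "\<not> p m < p k"
      then have "p k \<noteq> p m" "p k \<noteq> 0"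
        using injD[OF permutes_inj[OF p], of k m] permutes_eq_0_iff[of k] by auto
      with k have "p k \<in> {1..<p m}" by auto
      with r have "inv p (p k) < inv p (p m)" unfolding record_at_def by blast
      with k show False by (simp add: permutes_inverses[OF p])
    qed
  next
    assume r: "\<forall>k\<in>{m<..n}. p m < p k"
    show "record_at (inv p) (p m)"
      unfolding record_at_def
    proof (rule ballI, rule ccontr)
      fix i assume i: "i \<in> {1..<p m}" "\<not> inv p i < inv p (p m)"
      have "p m \<in> {1..n}" using permutes_in_image[OF p] that by blast
      with i have "inv p i \<in> {1..n}"
        using permutes_in_image[OF permutes_inv[OF p], of i] by auto
      moreover have "inv p i \<noteq> m" using i permutes_inverses[OF p] by auto
      ultimately have "inv p i \<in> {m<..n}" using i by (simp add: permutes_inverses[OF p])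
      with r have "p m < p (inv p i)" by blast
      with i show False by (simp add: permutes_inverses[OF p])
    qed
  qed
  \<comment> \<open>\<open>M\<close> lists the positions of the minima; applying \<open>p\<close> to
    it later yields their values.\<close>
  define M where "M = {m \<in> {1..n}. p m \<notin> N \<and> (\<forall>k\<in>{m<..n}. p m < p k)}"
  have "RLM_B n (signed_perm p N) = signed_perm p N `
      {i \<in> {1..int n}. 0 < signed_perm p N i \<and>
        (\<forall>j\<in>{i<..int n}. signed_perm p N i < \<bar>signed_perm p N j\<bar>)}"
    by (auto simp: RLM_B_def)
  also have "{i \<in> {1..int n}. 0 < signed_perm p N i \<and>
        (\<forall>j\<in>{i<..int n}. signed_perm p N i < \<bar>signed_perm p N j\<bar>)}
      = int ` M"
  proof -
    have iff: "0 < signed_perm p N (int m) \<and>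
        (\<forall>j\<in>{int m<..int n}. signed_perm p N (int m) < \<bar>signed_perm p N j\<bar>) \<longleftrightarrow> m \<in> M"
      if m: "m \<in> {1..n}" for m
    proof (cases "p m \<in> N")
      case True
      with m show ?thesis
        using signed_perm_neg_iff[of "int m"] by (simp add: M_def)
    next
      case False
      have val: "signed_perm p N (int m) = int (p m)" "p m \<noteq> 0"
        using m False permutes_eq_0_iff[of m] by (simp_all add: signed_perm_def)
      have "(\<forall>j\<in>{int m<..int n}. p m < p (nat \<bar>j\<bar>)) \<longleftrightarrow> (\<forall>k\<in>{m<..n}. p m < p k)"
      proof (intro iffI ballI)
        fix k assume "\<forall>j\<in>{int m<..int n}. p m < p (nat \<bar>j\<bar>)" "k \<in> {m<..n}"
        then show "p m < p k" by (auto dest: bspec[of _ _ "int k"])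
      next
        fix j assume "\<forall>k\<in>{m<..n}. p m < p k" "j \<in> {int m<..int n}"
        moreover from this have "nat \<bar>j\<bar> \<in> {m<..n}" by auto
        ultimately show "p m < p (nat \<bar>j\<bar>)" by blast
      qed
      then show ?thesis
        using m False val by (simp add: M_def abs_signed_perm)
    qed
    have range: "{1..int n} = int ` {1..n}"
      by (simp add: image_int_atLeastAtMost)
    show ?thesis
      unfolding range Compr_image_eq
    proof (rule arg_cong[of _ _ "image int"], rule set_eqI)
      fix m
      have "m \<in> M \<Longrightarrow> m \<in> {1..n}" by (simp add: M_def)
      with iff[of m] show "m \<in> {m \<in> {1..n}. 0 < signed_perm p N (int m) \<and>
          (\<forall>j\<in>{int m<..int n}. signed_perm p N (int m) < \<bar>signed_perm p N j\<bar>)} \<longleftrightarrow> m \<in> M"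
        by blast
    qed
  qed
  also have "signed_perm p N ` int ` M = int ` p ` M"
    unfolding image_image by (intro image_cong refl) (simp add: M_def signed_perm_def)
  also have "M = {m \<in> {1..n}. p m \<notin> N \<and> record_at (inv p) (p m)}"
    using rec by (auto simp: M_def)
  also have "p ` \<dots> = {j \<in> p ` {1..n}. j \<notin> N \<and> record_at (inv p) j}"
    by blast
  also have "\<dots> = {j \<in> {1..n} - N. record_at (inv p) j}"
    unfolding permutes_image[OF p] by blast
  finally show ?thesis .
qed

context
  assumes N: "N \<subseteq> {1..n}"
begin

text \<open>Equal images force arguments equal up to sign, and oddness settles the sign. Outside the
  range \<open>p\<close> fixes the absolute value and \<open>N\<close> does not contain it, so
  nothing moves.\<close>

lemma signed_perm_in_signed_perms: "signed_perm p N \<in> signed_perms n"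
proof -
  let ?\<sigma> = "signed_perm p N" and ?A = "{- int n..int n} - {0}"
  have odd: "?\<sigma> (- i) = - ?\<sigma> i" for i
    by (simp add: signed_perm_def sgn_minus)
  have nz: "?\<sigma> i = 0 \<longleftrightarrow> i = 0" for i
    using abs_signed_perm[of i] permutes_eq_0_iff[of "nat \<bar>i\<bar>"] by auto
  have "inj ?\<sigma>"
  proof (rule injI)
    fix i j assume eq: "?\<sigma> i = ?\<sigma> j"
    then have "p (nat \<bar>i\<bar>) = p (nat \<bar>j\<bar>)"
      using abs_signed_perm by (metis of_nat_eq_iff)
    then have "\<bar>i\<bar> = \<bar>j\<bar>"
      using injD[OF permutes_inj[OF p]] by fastforce
    then have "i = j \<or> i = - j" by auto
    then show "i = j"
      using eq odd[of j] nz[of j] by auto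
  qed
  moreover have "?\<sigma> ` ?A \<subseteq> ?A"
  proof (rule image_subsetI)
    fix i assume i: "i \<in> ?A"
    then have "nat \<bar>i\<bar> \<in> {1..n}" by auto
    then have "p (nat \<bar>i\<bar>) \<in> {1..n}"
      using permutes_in_image[OF p] by blast
    then show "?\<sigma> i \<in> ?A"
      using abs_signed_perm[of i] by auto
  qed
  ultimately have "bij_betw ?\<sigma> ?A ?A"
    using inj_on_subset[of ?\<sigma> UNIV ?A] by (simp add: bij_betw_def endo_inj_surj)
  moreover have "?\<sigma> i = i" if "i \<notin> ?A" for i
  proof -
    have "nat \<bar>i\<bar> \<notin> {1..n}" using that by auto
    then have "p (nat \<bar>i\<bar>) = nat \<bar>i\<bar>" "i \<noteq> 0 \<Longrightarrow> nat \<bar>i\<bar> \<notin> N"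
      using permutes_not_in[OF p] N by blast+
    then show ?thesis by (auto simp: signed_perm_def sgn_if)
  qed
  ultimately have "?\<sigma> permutes ?A"
    by (rule bij_imp_permutes)
  with odd show ?thesis by (simp add: signed_perms_def)
qed

text \<open>\<open>Neg\<close> consists of positions and \<open>N\<close> of values. Through this
  bijection \<open>neg\<close> and \<open>nsum\<close> become functions of \<open>N\<close>
  alone.\<close>

lemma bij_betw_neg: "bij_betw p {m \<in> {1..n}. p m \<in> N} N"
proof (rule bij_betw_imageI)
  show "inj_on p {m \<in> {1..n}. p m \<in> N}"
    using permutes_inj_on[OF p] .
  have "p ` {m \<in> {1..n}. p m \<in> N} = p ` {1..n} \<inter> N"
    by blast
  then show "p ` {m \<in> {1..n}. p m \<in> N} = N"
    unfolding permutes_image[OF p] using N by blast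
qed

lemma neg_signed_perm: "neg n (signed_perm p N) = card N"
  using bij_betw_same_card[OF bij_betw_neg] by (simp add: neg_def Neg_signed_perm card_image)

lemma nsum_signed_perm: "nsum n (signed_perm p N) = \<Sum>N"
  using sum.reindex_bij_betw[OF bij_betw_neg, of "\<lambda>j. j"]
  by (simp add: nsum_def Neg_signed_perm abs_signed_perm sum.reindex)

lemma neg_values_signed_perm: "neg_values n (signed_perm p N) = N"
proof (rule set_eqI)
  fix j
  show "j \<in> neg_values n (signed_perm p N) \<longleftrightarrow> j \<in> N"
  proof
    assume "j \<in> neg_values n (signed_perm p N)"
    then obtain i where i: "j \<in> {1..n}" "i \<in> {1..int n}" "- int j = signed_perm p N i"
      by (auto simp: neg_values_def)
    then have "p (nat i) = j"
      using abs_signed_perm[of i] by auto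
    with i show "j \<in> N" using signed_perm_neg_iff[of i] by auto
  next
    assume "j \<in> N"
    then have "j \<in> p ` {1..n}" using N permutes_image[OF p] by auto
    then obtain m where m: "m \<in> {1..n}" "p m = j" by auto
    then have "signed_perm p N (int m) = - int j"
      using \<open>j \<in> N\<close> by (simp add: signed_perm_def)
    moreover have "int m \<in> {1..int n}" using m by simp
    ultimately have "- int j \<in> signed_perm p N ` {1..int n}" by (metis imageI)
    with \<open>j \<in> N\<close> N show "j \<in> neg_values n (signed_perm p N)"
      by (auto simp: neg_values_def)
  qed
qed

end

end

text \<open>Both sides are odd and trivial outside the range, so it is enough to compare them on
  positive positions.\<close>

lemma signed_perm_abs_perm:
  assumes \<sigma>: "\<sigma> \<in> signed_perms n"
  shows "signed_perm (abs_perm \<sigma>) (neg_values n \<sigma>) = \<sigma>"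
proof
  have perm: "\<sigma> permutes {- int n..int n} - {0}"
    using \<sigma> by (simp add: signed_perms_def)
  let ?\<sigma>' = "signed_perm (abs_perm \<sigma>) (neg_values n \<sigma>)"
  have \<sigma>': "?\<sigma>' \<in> signed_perms n"
    by (intro signed_perm_in_signed_perms abs_perm_permutes \<sigma>) (auto simp: neg_values_def)
  have pos: "?\<sigma>' i = \<sigma> i" if i: "i \<in> {1..int n}" for i
  proof -
    have im: "\<sigma> i \<in> {- int n..int n} - {0}"
      using permutes_in_image[OF perm, of i] i by auto
    \<comment> \<open>If \<open>\<sigma> i\<close> is positive, its negative is the image of
      \<open>- i\<close>, hence by injectivity of no positive position.\<close>
    have "\<sigma> i < 0 \<longleftrightarrow> - \<bar>\<sigma> i\<bar> \<in> \<sigma> ` {1..int n}"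
    proof
      assume "- \<bar>\<sigma> i\<bar> \<in> \<sigma> ` {1..int n}"
      then obtain j where j: "j \<in> {1..int n}" "\<sigma> j = - \<bar>\<sigma> i\<bar>" by force
      show "\<sigma> i < 0"
      proof (rule ccontr)
        assume "\<not> \<sigma> i < 0"
        then have "\<sigma> j = \<sigma> (- i)" using j signed_perms_minus[OF \<sigma>, of i] by simp
        then have "j = - i" using permutes_inj[OF perm] by (metis injD)
        with i j show False by simp
      qed
    qed (use i in auto)
    then have "abs_perm \<sigma> (nat \<bar>i\<bar>) \<in> neg_values n \<sigma> \<longleftrightarrow> \<sigma> i < 0"
      using i im by (auto simp: abs_perm_def neg_values_def)
    then show ?thesis
      using i by (simp add: signed_perm_def abs_perm_def)
  qed
  fix i
  consider "i \<in> {1..int n}" | "- i \<in> {1..int n}" | "i \<notin> {- int n..int n} - {0}"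
    by fastforce
  then show "?\<sigma>' i = \<sigma> i"
  proof cases
    case 2
    then show ?thesis
      using pos[of "- i"] by (simp add: signed_perms_minus[OF \<sigma>] signed_perms_minus[OF \<sigma>'])
  next
    case 3
    then show ?thesis
      using permutes_not_in[OF perm] permutes_not_in[of ?\<sigma>'] \<sigma>' unfolding signed_perms_def by auto
  qed (rule pos)
qed

text \<open>The underlying permutation and the set of negated values range independently, which lets
  the signs be summed first.\<close>

lemma sum_signed_perms:
  "(\<Sum>\<sigma>\<in>signed_perms n. f \<sigma>) =
   (\<Sum>p | p permutes {1..n}. \<Sum>N\<in>Pow {1..n}. f (signed_perm p N))"
proof -
  have "(\<Sum>\<sigma>\<in>signed_perms n. f \<sigma>) =
      (\<Sum>(p, N)\<in>{p. p permutes {1..n}} \<times> Pow {1..n}. f (signed_perm p N))"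
  proof (rule sum.reindex_bij_witness[where i = "\<lambda>(p, N). signed_perm p N"
          and j = "\<lambda>\<sigma>. (abs_perm \<sigma>, neg_values n \<sigma>)"])
    fix \<sigma> assume "\<sigma> \<in> signed_perms n"
    moreover have "neg_values n \<sigma> \<subseteq> {1..n}" by (auto simp: neg_values_def)
    ultimately show "(abs_perm \<sigma>, neg_values n \<sigma>) \<in> {p. p permutes {1..n}} \<times> Pow {1..n}"
      using abs_perm_permutes by auto
  next
    fix x assume "x \<in> {p. p permutes {1..n}} \<times> Pow {1..n}"
    then obtain p N where x: "x = (p, N)" and p: "p permutes {1..n}" and N: "N \<subseteq> {1..n}"
      by blast
    show "(\<lambda>(p, N). signed_perm p N) x \<in> signed_perms n"
      using signed_perm_in_signed_perms[OF p N] by (simp add: x)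
    show "(abs_perm ((\<lambda>(p, N). signed_perm p N) x),
        neg_values n ((\<lambda>(p, N). signed_perm p N) x)) = x"
      using abs_perm_signed_perm[OF p] neg_values_signed_perm[OF p N] by (simp add: x)
  qed (auto simp: signed_perm_abs_perm)
  then show ?thesis
    by (simp add: sum.cartesian_product)
qed

section \<open>Summing out the signs and evaluating the remaining sum\<close>

theorem theorem4p6:
  fixes n :: nat
  assumes "n \<ge> 1"
  shows "(\<Sum>\<sigma>\<in>signed_perms n.
            (-1) ^ cyc n \<sigma> * s ^ neg n \<sigma> * t ^ nsum n \<sigma> * (\<Prod>j\<in>RLM_B n \<sigma>. y (nat j)))
       = (-1) ^ n * (\<Prod>i\<in>{i \<in> {1..n}. even i}. y i - 1) * (\<Prod>i\<in>{i \<in> {1..n}. odd i}. y i + s * t ^ i)"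
proof -
  define a where "a = (\<lambda>j. y j + s * t ^ j)"
  define b where "b = (\<lambda>j. 1 + s * t ^ j)"
  \<comment> \<open>The result is phrased with \<open>inv p\<close>, whose records are the
    right-to-left minima of \<open>p\<close>; inversion preserves the sign.\<close>
  have inner: "(\<Sum>N\<in>Pow {1..n}. (-1) ^ cyc n (signed_perm p N) * s ^ neg n (signed_perm p N) *
        t ^ nsum n (signed_perm p N) * (\<Prod>j\<in>RLM_B n (signed_perm p N). y (nat j)))
      = (-1) ^ n * (of_int (sign (inv p)) * record_weight a b n (inv p))"
    if p: "p permutes {1..n}" for p
  proof -
    have "(-1) ^ card (orbit p ` {1..n}) = (of_int ((-1) ^ n * sign p) :: polynomial)"
      using minus_one_power_card_orbits[OF _ p]
      by (metis card_atLeastAtMost diff_Suc_1 finite_atLeastAtMost of_int_1 of_int_minus of_int_power)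
    moreover have "sign (inv p) = sign p"
      using p by (auto intro!: sign_inverse simp: permutation_permutes)
    moreover have "(\<Sum>N\<in>Pow {1..n}. s ^ card N * t ^ \<Sum>N *
        (\<Prod>j\<in>{j \<in> {1..n} - N. record_at (inv p) j}. y j)) = record_weight a b n (inv p)"
    proof -
      \<comment> \<open>Expanding the product chooses from each factor either
        \<open>s * t ^ j\<close>, which puts \<open>j\<close> into \<open>N\<close>, or the other
        summand, where \<open>j\<close> is positive.\<close>
      have "record_weight a b n (inv p) =
          (\<Prod>j\<in>{1..n}. s * t ^ j + (if record_at (inv p) j then y j else 1))"
        unfolding record_weight_def by (intro prod.cong) (auto simp: a_def b_def)
      also have "\<dots> = (\<Sum>N\<in>Pow {1..n}. (\<Prod>j\<in>N. s * t ^ j) *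
          (\<Prod>j\<in>{1..n} - N. if record_at (inv p) j then y j else 1))"
        by (rule prod_add) simp
      also have "\<dots> = (\<Sum>N\<in>Pow {1..n}. s ^ card N * t ^ \<Sum>N *
          (\<Prod>j\<in>{j \<in> {1..n} - N. record_at (inv p) j}. y j))"
        by (subst prod.inter_filter) (simp_all add: prod.distrib power_sum)
      finally show ?thesis by (rule sym)
    qed
    ultimately show ?thesis
      using p by (simp add: cyc_def abs_perm_signed_perm neg_signed_perm nsum_signed_perm
          RLM_B_signed_perm prod.reindex mult.assoc flip: sum_distrib_left)
  qed
  have "(\<Sum>\<sigma>\<in>signed_perms n.
            (-1) ^ cyc n \<sigma> * s ^ neg n \<sigma> * t ^ nsum n \<sigma> * (\<Prod>j\<in>RLM_B n \<sigma>. y (nat j)))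
      = (\<Sum>p | p permutes {1..n}. (-1) ^ n * (of_int (sign (inv p)) * record_weight a b n (inv p)))"
    unfolding sum_signed_perms by (intro sum.cong refl inner) simp
  \<comment> \<open>Inversion permutes the index set, so \<open>inv p\<close> may be replaced by
    \<open>p\<close>.\<close>
  also have "\<dots> = (-1) ^ n * (\<Sum>p | p permutes {1..n}. of_int (sign p) * record_weight a b n p)"
    by (subst (2) sum_permutations_inverse) (simp add: sum_distrib_left)
  \<comment> \<open>For even \<open>i\<close> the terms \<open>s * t ^ i\<close> cancel in
    \<open>a i - b i\<close>. The filler 1 separates the product by parity.\<close>
  also have "\<dots> = (-1) ^ n * (\<Prod>i\<in>{1..n}. (if even i then y i - 1 else 1) *
      (if odd i then y i + s * t ^ i else 1))"
    unfolding sum_sign_record_weight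
    by (intro arg_cong[of _ _ "(*) _"] prod.cong) (auto simp: a_def b_def)
  finally show ?thesis
    by (simp only: prod.inter_filter[OF finite_atLeastAtMost] prod.distrib mult.assoc)
qed

end
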